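(* Let $K\subseteq\mathbb{R}^d$ and let $C\subset\mathbb{R}^d$ be a compact convex set with $0\in\operatorname{int}(C)$. Then $$r_\pi^1(K,C)\geq\cdots\geq r_\pi^d(K,C),\qquad r^\pi_1(K,C)\geq\cdots\geq r^\pi_d(K,C),$$ $$r^\sigma_1(K,C)\geq\cdots\geq r^\sigma_d(K,C),\qquad r_\sigma^1(K,C)\geq\cdots\geq r_\sigma^d(K,C).$$
   Context: For $0\le i\le d$, $\mathcal{L}^d_i$ denotes the family of all $i$-dimensional linear subspaces of $\mathbb{R}^d$. Sums of sets are Minkowski sums. All infima and suprema are taken in $\mathbb{R}\cup\{\pm\infty\}$, with $\inf\emptyset=+\infty$ and $\sup\emptyset=-\infty$. For sets $A,D\subseteq\mathbb{R}^d$ put $$r(A,D)=\sup_{y\in\mathbb{R}^d}\sup\{\lambda\geq 0 : y+\lambda D\subseteq A\},$$ (so that, if $D=\emptyset$, then $y+\lambda D=\emptyset$ and $r(A,D)=+\infty$). For $j\in\{1,\ldots,d\}$ define $$r_\pi^j(K,C)=\sup_{L\in\mathcal{L}^d_{d-j}} r(K+L,C),\qquad r^\pi_j(K,C)=\inf_{L\in\mathcal{L}^d_{d-j}} r(K+L,C),$$ $$r_\sigma^j(K,C)=\sup_{L\in\mathcal{L}^d_j}\ \inf_{x\in\mathbb{R}^d} r(K,C\cap(x+L)),\qquad r^\sigma_j(K,C)=\inf_{L\in\mathcal{L}^d_j}\ \inf_{x\in\mathbb{R}^d} r(K,C\cap(x+L)).$$ *)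

theory Defs
  imports "HOL-Analysis.Analysis" "HOL-Library.Set_Algebras"
begin

definition lin_subspaces :: "nat \<Rightarrow> (real ^ 'n) set set" where
  "lin_subspaces i = {L. subspace L \<and> dim L = i}"

text \<open>
  Suprema and infima are taken in the complete lattice of extended reals, so that the supremum of
  the empty set is minus infinity. In particular the value is minus infinity if A is empty and
  D is not, and plus infinity if D is empty.
\<close>

definition inradius :: "(real ^ 'n) set \<Rightarrow> (real ^ 'n) set \<Rightarrow> ereal" where
  "inradius A D =
    (SUP y. SUP l \<in> {l::real. 0 \<le> l \<and> (\<lambda>x. y + l *\<^sub>R x) ` D \<subseteq> A}. ereal l)"

text \<open>
  Successive radii: \<open>pi\<close> stands for projections (Minkowski sums of K with a subspace of dimension
  d - j), \<open>sigma\<close> for sections of C. The suffix \<open>upper\<close> means the supremum over all subspaces of the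
  given dimension (index j as a superscript on r), the suffix \<open>lower\<close> the infimum (index j as a
  subscript). Subtraction on nat does not truncate for the relevant indices, 1 to d.
\<close>

definition r_pi_upper :: "nat \<Rightarrow> (real ^ 'n) set \<Rightarrow> (real ^ 'n) set \<Rightarrow> ereal" where
  "r_pi_upper j K C = (SUP L \<in> lin_subspaces (CARD('n) - j). inradius (K + L) C)"

definition r_pi_lower :: "nat \<Rightarrow> (real ^ 'n) set \<Rightarrow> (real ^ 'n) set \<Rightarrow> ereal" where
  "r_pi_lower j K C = (INF L \<in> lin_subspaces (CARD('n) - j). inradius (K + L) C)"

definition r_sigma_upper :: "nat \<Rightarrow> (real ^ 'n) set \<Rightarrow> (real ^ 'n) set \<Rightarrow> ereal" where
  "r_sigma_upper j K C = (SUP L \<in> lin_subspaces j. INF x. inradius K (C \<inter> (+) x ` L))"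

definition r_sigma_lower :: "nat \<Rightarrow> (real ^ 'n) set \<Rightarrow> (real ^ 'n) set \<Rightarrow> ereal" where
  "r_sigma_lower j K C = (INF L \<in> lin_subspaces j. INF x. inradius K (C \<inter> (+) x ` L))"

end

theory Submission
  imports Defs
begin

text \<open>The inradius \<open>inradius A D\<close> grows with \<open>A\<close> and shrinks as
  \<open>D\<close> grows (\<open>inradius_mono\<close>). Hence enlarging \<open>L\<close> raises
  \<open>inradius (K + L) C\<close> and lowers the radius for each section of \<open>C\<close> by a
  translate of \<open>L\<close>. Passing from \<open>j\<close> to \<open>Suc j\<close> lowers the
  dimension of \<open>L\<close> by one for the pi radii and raises it by one for the sigma radii, so
  in both cases the radius drops along nested subspaces. Nested partners exist in both directions:
  \<open>lin_subspaces_Suc_contains\<close> goes down one dimension,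
  \<open>lin_subspaces_extend_Suc\<close> goes up. A supremum needs a partner for each subspace of
  the family at \<open>Suc j\<close>, an infimum one for each subspace of the family at
  \<open>j\<close>.\<close>

lemma lin_subspaces_Suc_contains:
  fixes L :: "(real ^ 'n) set"
  assumes "L \<in> lin_subspaces (Suc i)"
  obtains M where "M \<in> lin_subspaces i" "M \<subseteq> L"
proof -
  from assms have L: "subspace L" "dim L = Suc i"
    by (auto simp: lin_subspaces_def)
  then obtain M where "subspace M" "M \<subseteq> span L" "dim M = i"
    using choose_subspace_of_subspace[of i L] by auto
  with L show thesis
    using that by (auto simp: lin_subspaces_def span_eq_iff[THEN iffD2])
qed

lemma lin_subspaces_extend_Suc:
  fixes L :: "(real ^ 'n) set"
  assumes "L \<in> lin_subspaces i" "i < CARD('n)"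
  obtains M where "M \<in> lin_subspaces (Suc i)" "L \<subseteq> M"
proof -
  from assms have L: "subspace L" "dim L = i"
    by (auto simp: lin_subspaces_def)
  with assms(2) have "L \<noteq> UNIV"
    by auto
  then obtain x where "x \<notin> L"
    by auto
  with L have "dim (span (insert x L)) = Suc i"
    by (simp add: dim_insert span_eq_iff[THEN iffD2])
  then have "span (insert x L) \<in> lin_subspaces (Suc i)"
    by (simp add: lin_subspaces_def del: dim_span)
  moreover have "L \<subseteq> span (insert x L)"
    by (meson insert_subset span_superset)
  ultimately show thesis
    by (rule that)
qed

text \<open>A pair of translation \<open>y\<close> and factor \<open>l\<close> admissible for
  \<open>A\<close> and \<open>D\<close> stays admissible for \<open>B\<close> and \<open>E\<close>,
  so the supremum runs over a larger set.\<close>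

lemma inradius_mono: "A \<subseteq> B \<Longrightarrow> E \<subseteq> D \<Longrightarrow> inradius A D \<le> inradius B E"
  unfolding inradius_def by (intro SUP_mono' SUP_subset_mono) auto

theorem theorem3p6:
  fixes K C :: "(real ^ 'n) set"
  assumes "compact C" and "convex C" and "0 \<in> interior C"
  shows "(\<forall>j \<in> {1..<CARD('n)}. r_pi_upper j K C \<ge> r_pi_upper (Suc j) K C) \<and>
         (\<forall>j \<in> {1..<CARD('n)}. r_pi_lower j K C \<ge> r_pi_lower (Suc j) K C) \<and>
         (\<forall>j \<in> {1..<CARD('n)}. r_sigma_lower j K C \<ge> r_sigma_lower (Suc j) K C) \<and>
         (\<forall>j \<in> {1..<CARD('n)}. r_sigma_upper j K C \<ge> r_sigma_upper (Suc j) K C)"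
proof (intro conjI ballI)
  fix j assume j: "j \<in> {1..<CARD('n)}"
  \<comment> \<open>Since j < d, the codimension d - j is a true successor, which brings both pi
    families into the form of the two subspace lemmas.\<close>
  then have codim: "CARD('n) - j = Suc (CARD('n) - Suc j)" and lt: "CARD('n) - Suc j < CARD('n)"
    by auto
  have pi: "inradius (K + L) C \<le> inradius (K + M) C" if "L \<subseteq> M" for L M
    using that by (intro inradius_mono set_plus_mono2) auto
  have sigma: "inradius K (C \<inter> (+) x ` M) \<le> inradius K (C \<inter> (+) x ` L)" if "L \<subseteq> M" for L M x
    using that by (intro inradius_mono) auto
  show "r_pi_upper j K C \<ge> r_pi_upper (Suc j) K C"
    unfolding r_pi_upper_def codim by (intro SUP_mono) (metis lin_subspaces_extend_Suc lt pi)
  \<comment> \<open>For the infimum the partner is sought downwards: each subspace of dimension d -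
    j contains one of dimension d - j - 1.\<close>
  show "r_pi_lower j K C \<ge> r_pi_lower (Suc j) K C"
    unfolding r_pi_lower_def codim by (intro INF_mono) (metis lin_subspaces_Suc_contains pi)
  show "r_sigma_lower j K C \<ge> r_sigma_lower (Suc j) K C"
    unfolding r_sigma_lower_def
  proof (intro INF_mono)
    fix L :: "(real ^ 'n) set" assume "L \<in> lin_subspaces j"
    with j obtain M where "M \<in> lin_subspaces (Suc j)" "L \<subseteq> M"
      by (auto elim: lin_subspaces_extend_Suc)
    then show "\<exists>M\<in>lin_subspaces (Suc j). (INF x. inradius K (C \<inter> (+) x ` M))
        \<le> (INF x. inradius K (C \<inter> (+) x ` L))"
      \<comment> \<open>The infima over \<open>x\<close> are compared pointwise, with the same
        translation for both subspaces.\<close>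
      by (intro bexI[of _ M] INF_mono' sigma)
  qed
  show "r_sigma_upper j K C \<ge> r_sigma_upper (Suc j) K C"
    unfolding r_sigma_upper_def
  proof (intro SUP_mono)
    fix M :: "(real ^ 'n) set" assume "M \<in> lin_subspaces (Suc j)"
    then obtain L where "L \<in> lin_subspaces j" "L \<subseteq> M"
      by (rule lin_subspaces_Suc_contains)
    then show "\<exists>L\<in>lin_subspaces j. (INF x. inradius K (C \<inter> (+) x ` M))
        \<le> (INF x. inradius K (C \<inter> (+) x ` L))"
      by (intro bexI[of _ L] INF_mono' sigma)
  qed
qed

end
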